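(* Let $(M,N,\nabla,\pi,h)$ be a contraction of chain complexes over a commutative ring $R$ with unit, with $\nabla\colon M\to N$, $\pi\colon N\to M$, $h\colon N\to N$; let $\partial$ be a perturbation of the differential $d$ on $N$, and suppose that the degree zero endomorphisms $\mathrm{Id}_N+h\partial$ and $\mathrm{Id}_N+\partial h$ of $N$ are invertible. Let $\alpha=(\mathrm{Id}_N+h\partial)^{-1}$, $\beta=(\mathrm{Id}_N+\partial h)^{-1}$, and $$\mathcal D=\pi\partial\alpha\nabla=\pi\beta\partial\nabla\colon M\to M,\quad \nabla_\partial=\alpha\nabla\colon M\to N,\quad \pi_\partial=\pi\beta\colon N\to M,\quad h_\partial=\alpha h=h\beta\colon N\to N.$$ Let $M_{\mathcal D}$ denote $M$ endowed with the operator $d+\mathcal D$ ($d$ the differential of $M$) and let $N_\partial$ denote $N$ endowed with $d+\partial$. Then $(M_{\mathcal D},N_\partial,\nabla_\partial,\pi_\partial,h_\partial)$ constitutes a contraction.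
   Context: Chain complexes are over $R$, with differential of degree $-1$, always written $d$. For a homogeneous operator $f$ on $N$ of degree $1$, $Df=df+fd$. A weak contraction $(M,N,\nabla,\pi,h)$ consists of chain complexes $M$ and $N$, a surjective chain map $\pi\colon N\to M$, an injective chain map $\nabla\colon M\to N$, and a morphism $h\colon N\to N$ of the underlying graded modules of degree $1$, subject to $Dh=\mathrm{Id}_N-\nabla\pi$ and $hh=0$. A contraction is a weak contraction subject to, furthermore, $\pi\nabla=\mathrm{Id}_M$, $\pi h=0$, and $h\nabla=0$. A perturbation $\partial$ of the differential $d$ on $N$ is a homogeneous degree $-1$ operator $\partial$ on $N$ such that $d+\partial$ has square zero. *)

theory Defs
  imports "HOL-Algebra.Module"
begin

text \<open>
  A graded \<open>R\<close>-module is a family \<open>M n\<close> of \<open>R\<close>-modules indexed by \<open>n :: int\<close>, and a homogeneous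
  operator \<open>M \<rightarrow> N\<close> of degree \<open>k\<close> is a family of \<open>R\<close>-linear maps \<open>f n : M n \<rightarrow> N (n + k)\<close>.
  Only the values on the carriers matter, so operators are compared by \<open>gr_eq\<close>, not by \<open>=\<close>.
\<close>

definition linear_maps ::
  "('r, 'c) ring_scheme \<Rightarrow> ('r, 'a, 'd) module_scheme \<Rightarrow> ('r, 'b, 'e) module_scheme \<Rightarrow> ('a \<Rightarrow> 'b) set"
  where "linear_maps R M N =
    {f \<in> carrier M \<rightarrow> carrier N.
       (\<forall>x\<in>carrier M. \<forall>y\<in>carrier M. f (x \<oplus>\<^bsub>M\<^esub> y) = f x \<oplus>\<^bsub>N\<^esub> f y) \<and>
       (\<forall>r\<in>carrier R. \<forall>x\<in>carrier M. f (r \<odot>\<^bsub>M\<^esub> x) = r \<odot>\<^bsub>N\<^esub> f x)}"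

type_synonym ('r, 'm) gr_module = "int \<Rightarrow> ('r, 'm) module"
type_synonym ('m, 'n) gr_op = "int \<Rightarrow> 'm \<Rightarrow> 'n"

definition gr_hom ::
  "('r, 'c) ring_scheme \<Rightarrow> ('r, 'm) gr_module \<Rightarrow> ('r, 'n) gr_module \<Rightarrow> int \<Rightarrow> ('m, 'n) gr_op \<Rightarrow> bool"
  where "gr_hom R M N k f \<longleftrightarrow> (\<forall>n. f n \<in> linear_maps R (M n) (N (n + k)))"

definition gr_eq :: "('r, 'm) gr_module \<Rightarrow> ('m, 'n) gr_op \<Rightarrow> ('m, 'n) gr_op \<Rightarrow> bool"
  where "gr_eq M f g \<longleftrightarrow> (\<forall>n. \<forall>x\<in>carrier (M n). f n x = g n x)"

text \<open>The composite \<open>f \<cdot>\<^bsub>k\<^esub> g\<close> of \<open>f\<close> after \<open>g\<close>, where \<open>k\<close> is the degree of the inner operator \<open>g\<close>.\<close>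

definition gr_comp :: "('n, 'p) gr_op \<Rightarrow> int \<Rightarrow> ('m, 'n) gr_op \<Rightarrow> ('m, 'p) gr_op"
    (\<open>_ \<cdot>\<^bsub>_\<^esub> _\<close> [71, 0, 70] 70)
  where "f \<cdot>\<^bsub>k\<^esub> g = (\<lambda>n x. f (n + k) (g n x))"

definition gr_id :: "('m, 'm) gr_op"
  where "gr_id = (\<lambda>n x. x)"

text \<open>In the next three definitions \<open>N\<close> is the target and \<open>k\<close> the (common) degree of the operators.\<close>

definition gr_zero :: "('r, 'n) gr_module \<Rightarrow> int \<Rightarrow> ('m, 'n) gr_op"
  where "gr_zero N k = (\<lambda>n x. \<zero>\<^bsub>N (n + k)\<^esub>)"

definition gr_add ::
  "('r, 'n) gr_module \<Rightarrow> int \<Rightarrow> ('m, 'n) gr_op \<Rightarrow> ('m, 'n) gr_op \<Rightarrow> ('m, 'n) gr_op"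
  where "gr_add N k f g = (\<lambda>n x. f n x \<oplus>\<^bsub>N (n + k)\<^esub> g n x)"

definition gr_diff ::
  "('r, 'n) gr_module \<Rightarrow> int \<Rightarrow> ('m, 'n) gr_op \<Rightarrow> ('m, 'n) gr_op \<Rightarrow> ('m, 'n) gr_op"
  where "gr_diff N k f g = (\<lambda>n x. f n x \<ominus>\<^bsub>N (n + k)\<^esub> g n x)"

definition gr_inj :: "('r, 'm) gr_module \<Rightarrow> ('m, 'n) gr_op \<Rightarrow> bool"
  where "gr_inj M f \<longleftrightarrow> (\<forall>n. inj_on (f n) (carrier (M n)))"

definition gr_surj :: "('r, 'm) gr_module \<Rightarrow> ('r, 'n) gr_module \<Rightarrow> int \<Rightarrow> ('m, 'n) gr_op \<Rightarrow> bool"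
  where "gr_surj M N k f \<longleftrightarrow> (\<forall>n. f n ` carrier (M n) = carrier (N (n + k)))"

definition gr_inverse ::
  "('r, 'c) ring_scheme \<Rightarrow> ('r, 'm) gr_module \<Rightarrow> ('m, 'm) gr_op \<Rightarrow> ('m, 'm) gr_op \<Rightarrow> bool"
  where "gr_inverse R M f g \<longleftrightarrow> gr_hom R M M 0 g \<and>
    gr_eq M (g \<cdot>\<^bsub>0\<^esub> f) gr_id \<and> gr_eq M (f \<cdot>\<^bsub>0\<^esub> g) gr_id"

definition gr_invertible ::
  "('r, 'c) ring_scheme \<Rightarrow> ('r, 'm) gr_module \<Rightarrow> ('m, 'm) gr_op \<Rightarrow> bool"
  where "gr_invertible R M f \<longleftrightarrow> gr_hom R M M 0 f \<and> (\<exists>g. gr_inverse R M f g)"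

text \<open>The inverse is unique up to \<open>gr_eq\<close>; \<open>SOME\<close> only picks its irrelevant values off the carriers.\<close>

definition gr_inv ::
  "('r, 'c) ring_scheme \<Rightarrow> ('r, 'm) gr_module \<Rightarrow> ('m, 'm) gr_op \<Rightarrow> ('m, 'm) gr_op"
  where "gr_inv R M f = (SOME g. gr_inverse R M f g)"

definition chain_complex ::
  "('r, 'c) ring_scheme \<Rightarrow> ('r, 'm) gr_module \<Rightarrow> ('m, 'm) gr_op \<Rightarrow> bool"
  where "chain_complex R M d \<longleftrightarrow> (\<forall>n. module R (M n)) \<and> gr_hom R M M (-1) d \<and>
    gr_eq M (d \<cdot>\<^bsub>-1\<^esub> d) (gr_zero M (-2))"

definition chain_map ::
  "('r, 'c) ring_scheme \<Rightarrow> ('r, 'm) gr_module \<Rightarrow> ('m, 'm) gr_op \<Rightarrow>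
   ('r, 'n) gr_module \<Rightarrow> ('n, 'n) gr_op \<Rightarrow> ('m, 'n) gr_op \<Rightarrow> bool"
  where "chain_map R M dM N dN f \<longleftrightarrow> gr_hom R M N 0 f \<and> gr_eq M (dN \<cdot>\<^bsub>0\<^esub> f) (f \<cdot>\<^bsub>-1\<^esub> dM)"

text \<open>\<open>Df = df + fd\<close> for an operator \<open>f\<close> of degree \<open>1\<close> on \<open>(N, d)\<close>.\<close>

definition gr_D :: "('r, 'n) gr_module \<Rightarrow> ('n, 'n) gr_op \<Rightarrow> ('n, 'n) gr_op \<Rightarrow> ('n, 'n) gr_op"
  where "gr_D N d f = gr_add N 0 (d \<cdot>\<^bsub>1\<^esub> f) (f \<cdot>\<^bsub>-1\<^esub> d)"

text \<open>The operators \<open>dM\<close> and \<open>dN\<close> are the differentials of \<open>M\<close> and \<open>N\<close>.\<close>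

definition weak_contraction ::
  "('r, 'c) ring_scheme \<Rightarrow> ('r, 'm) gr_module \<Rightarrow> ('m, 'm) gr_op \<Rightarrow>
   ('r, 'n) gr_module \<Rightarrow> ('n, 'n) gr_op \<Rightarrow>
   ('m, 'n) gr_op \<Rightarrow> ('n, 'm) gr_op \<Rightarrow> ('n, 'n) gr_op \<Rightarrow> bool"
  where "weak_contraction R M dM N dN nabla \<pi> h \<longleftrightarrow>
    chain_complex R M dM \<and> chain_complex R N dN \<and>
    chain_map R N dN M dM \<pi> \<and> gr_surj N M 0 \<pi> \<and>
    chain_map R M dM N dN nabla \<and> gr_inj M nabla \<and>
    gr_hom R N N 1 h \<and>
    gr_eq N (gr_D N dN h) (gr_diff N 0 gr_id (nabla \<cdot>\<^bsub>0\<^esub> \<pi>)) \<and>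
    gr_eq N (h \<cdot>\<^bsub>1\<^esub> h) (gr_zero N 2)"

definition contraction ::
  "('r, 'c) ring_scheme \<Rightarrow> ('r, 'm) gr_module \<Rightarrow> ('m, 'm) gr_op \<Rightarrow>
   ('r, 'n) gr_module \<Rightarrow> ('n, 'n) gr_op \<Rightarrow>
   ('m, 'n) gr_op \<Rightarrow> ('n, 'm) gr_op \<Rightarrow> ('n, 'n) gr_op \<Rightarrow> bool"
  where "contraction R M dM N dN nabla \<pi> h \<longleftrightarrow>
    weak_contraction R M dM N dN nabla \<pi> h \<and>
    gr_eq M (\<pi> \<cdot>\<^bsub>0\<^esub> nabla) gr_id \<and>
    gr_eq N (\<pi> \<cdot>\<^bsub>1\<^esub> h) (gr_zero M 1) \<and>
    gr_eq M (h \<cdot>\<^bsub>0\<^esub> nabla) (gr_zero N 1)"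

definition perturbation ::
  "('r, 'c) ring_scheme \<Rightarrow> ('r, 'n) gr_module \<Rightarrow> ('n, 'n) gr_op \<Rightarrow> ('n, 'n) gr_op \<Rightarrow> bool"
  where "perturbation R N d \<delta> \<longleftrightarrow> gr_hom R N N (-1) \<delta> \<and>
    gr_eq N (gr_add N (-1) d \<delta> \<cdot>\<^bsub>-1\<^esub> gr_add N (-1) d \<delta>) (gr_zero N (-2))"

end

theory Submission
  imports Defs
begin

text \<open>
  Put \<open>A = Id + h\<delta>\<close> and \<open>B = Id + \<delta>h\<close>. Since \<open>hB = Ah\<close> and \<open>\<delta>A = B\<delta>\<close>, one gets
  \<open>\<alpha>h = h\<beta>\<close> and \<open>\<beta>\<delta> = \<delta>\<alpha>\<close>; the annihilation properties of \<open>h\<close> give \<open>h\<alpha> = h\<close> and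
  \<open>\<pi>\<alpha> = \<pi>\<close>, and \<open>\<beta>\<close> fixes every element killed by \<open>h\<close>. This yields all side conditions.
  The compatibility with the differentials rests on
  \<open>A(d + \<delta>) = dA + \<nabla>\<pi>\<delta>\<close> and \<open>(d + \<delta>)B = Bd + \<delta>\<nabla>\<pi>\<close>, which follow from
  \<open>dh + hd + \<nabla>\<pi> = Id\<close> and \<open>(d + \<delta>)(d + \<delta>) = 0\<close>. Finally \<open>(d + \<D>)(d + \<D>) = 0\<close> because
  \<open>\<nabla>\<^sub>\<delta>\<close> is a split injection intertwining \<open>d + \<D>\<close> and \<open>d + \<delta>\<close>.
\<close>

subsection \<open>Homogeneous operators\<close>

text \<open>The target degree enters through the equation \<open>m = n + k\<close>, so that indices
  such as \<open>n - 1\<close> are matched by arithmetic and not by their syntactic form.\<close>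

lemma gr_hom_closed:
  assumes "gr_hom R M N k f" "x \<in> carrier (M n)" "m = n + k"
  shows "f n x \<in> carrier (N m)"
  using assms by (auto simp: gr_hom_def linear_maps_def)

lemma gr_hom_add:
  assumes "gr_hom R M N k f" "x \<in> carrier (M n)" "y \<in> carrier (M n)"
  shows "f n (x \<oplus>\<^bsub>M n\<^esub> y) = f n x \<oplus>\<^bsub>N (n + k)\<^esub> f n y"
  using assms by (auto simp: gr_hom_def linear_maps_def)

lemma gr_hom_smult:
  assumes "gr_hom R M N k f" "r \<in> carrier R" "x \<in> carrier (M n)"
  shows "f n (r \<odot>\<^bsub>M n\<^esub> x) = r \<odot>\<^bsub>N (n + k)\<^esub> f n x"
  using assms by (auto simp: gr_hom_def linear_maps_def)

lemma gr_hom_zero: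
  assumes "\<And>n. module R (M n)" "\<And>n. module R (N n)" "gr_hom R M N k f"
  shows "f n \<zero>\<^bsub>M n\<^esub> = \<zero>\<^bsub>N (n + k)\<^esub>"
proof -
  interpret M: module R "M n" by fact
  interpret N: module R "N (n + k)" by fact
  have cl: "f n \<zero>\<^bsub>M n\<^esub> \<in> carrier (N (n + k))"
    by (rule gr_hom_closed[OF assms(3)]) auto
  have "f n \<zero>\<^bsub>M n\<^esub> \<oplus>\<^bsub>N (n + k)\<^esub> f n \<zero>\<^bsub>M n\<^esub> = f n \<zero>\<^bsub>M n\<^esub>"
    using gr_hom_add[OF assms(3), of "\<zero>\<^bsub>M n\<^esub>" n "\<zero>\<^bsub>M n\<^esub>"] by simp
  then show ?thesis using cl by (metis N.add.l_cancel_one)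
qed

lemma gr_hom_comp:
  assumes "gr_hom R M N k g" "gr_hom R N P l f" "j = k + l"
  shows "gr_hom R M P j (f \<cdot>\<^bsub>k\<^esub> g)"
  unfolding gr_hom_def linear_maps_def
  by (auto simp: gr_comp_def gr_hom_closed[OF assms(1)] gr_hom_closed[OF assms(2)] assms(3)
      gr_hom_add[OF assms(1)] gr_hom_add[OF assms(2)]
      gr_hom_smult[OF assms(1)] gr_hom_smult[OF assms(2)] add.assoc)

lemma gr_hom_gr_add:
  assumes "\<And>n. module R (N n)" "gr_hom R M N k f" "gr_hom R M N k g"
  shows "gr_hom R M N k (gr_add N k f g)"
proof -
  interpret N: module R "N n" for n by (rule assms(1))
  note cl = gr_hom_closed[OF assms(2)] gr_hom_closed[OF assms(3)]
  show ?thesis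
    unfolding gr_hom_def linear_maps_def gr_add_def
    by (auto simp: cl gr_hom_add[OF assms(2)] gr_hom_add[OF assms(3)]
        gr_hom_smult[OF assms(2)] gr_hom_smult[OF assms(3)] N.smult_r_distr N.add.m_ac)
qed

lemma gr_inj_if_left_inverse:
  assumes "gr_eq M (p \<cdot>\<^bsub>0\<^esub> i) gr_id"
  shows "gr_inj M i"
  using assms unfolding gr_inj_def gr_eq_def gr_comp_def gr_id_def
  by (auto intro: inj_on_inverseI)

lemma gr_surj_if_right_inverse:
  assumes "gr_hom R M N 0 i" "gr_hom R N M 0 p" "gr_eq M (p \<cdot>\<^bsub>0\<^esub> i) gr_id"
  shows "gr_surj N M 0 p"
  unfolding gr_surj_def
proof (intro allI equalityI subsetI)
  fix n x assume "x \<in> carrier (M (n + 0))"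
  then have "p n (i n x) = x" "i n x \<in> carrier (N n)"
    using assms(3) gr_hom_closed[OF assms(1)] by (auto simp: gr_eq_def gr_comp_def gr_id_def)
  then show "x \<in> p n ` carrier (N n)" by (metis imageI)
qed (auto intro: gr_hom_closed[OF assms(2)])

lemma gr_inverse_gr_inv:
  assumes "gr_invertible R M f"
  shows "gr_inverse R M f (gr_inv R M f)"
  using assms unfolding gr_invertible_def gr_inv_def by (metis someI_ex)

subsection \<open>The perturbed contraction\<close>

text \<open>\<open>\<alpha>\<close> and \<open>\<beta>\<close> are arbitrary two-sided inverses, so
  nothing proved here depends on the choice made by \<open>gr_inv\<close>.\<close>

locale perturbed_contraction =
  fixes R :: "('r, 'c) ring_scheme"
    and M :: "('r, 'm) gr_module" and dM :: "('m, 'm) gr_op"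
    and N :: "('r, 'n) gr_module" and dN :: "('n, 'n) gr_op"
    and nabla :: "('m, 'n) gr_op" and \<pi> :: "('n, 'm) gr_op" and h :: "('n, 'n) gr_op"
    and \<delta> \<alpha> \<beta> :: "('n, 'n) gr_op"
  assumes contr: "contraction R M dM N dN nabla \<pi> h"
    and pert: "perturbation R N dN \<delta>"
    and inv_\<alpha>: "gr_inverse R N (gr_add N 0 gr_id (h \<cdot>\<^bsub>-1\<^esub> \<delta>)) \<alpha>"
    and inv_\<beta>: "gr_inverse R N (gr_add N 0 gr_id (\<delta> \<cdot>\<^bsub>1\<^esub> h)) \<beta>"
begin

section \<open>Pointwise form of the hypotheses\<close>

sublocale M: module R "M n" for n
  using contr by (simp add: contraction_def weak_contraction_def chain_complex_def)

sublocale N: module R "N n" for n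
  using contr by (simp add: contraction_def weak_contraction_def chain_complex_def)

text \<open>The order of the conclusions fixes the numbering in \<open>additive\<close> and
  \<open>zero\<close>: 4 is \<open>\<pi>\<close>, 5 is \<open>h\<close>, 7 is
  \<open>\<alpha>\<close>, 8 is \<open>\<beta>\<close>.\<close>

lemma homs:
  shows hom_dM: "gr_hom R M M (-1) dM" and hom_dN: "gr_hom R N N (-1) dN"
    and hom_nabla: "gr_hom R M N 0 nabla" and hom_\<pi>: "gr_hom R N M 0 \<pi>"
    and hom_h: "gr_hom R N N 1 h" and hom_\<delta>: "gr_hom R N N (-1) \<delta>"
    and hom_\<alpha>: "gr_hom R N N 0 \<alpha>" and hom_\<beta>: "gr_hom R N N 0 \<beta>"
  using contr pert inv_\<alpha> inv_\<beta>
  by (auto simp: contraction_def weak_contraction_def chain_complex_def chain_map_def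
      perturbation_def gr_inverse_def)

lemmas closed [simp] = homs[THEN gr_hom_closed]

lemmas additive [simp] = homs[THEN gr_hom_add]

lemmas zero [simp] =
  gr_hom_zero[OF M.module_axioms M.module_axioms hom_dM]
  gr_hom_zero[OF N.module_axioms N.module_axioms hom_dN]
  gr_hom_zero[OF M.module_axioms N.module_axioms hom_nabla]
  gr_hom_zero[OF N.module_axioms M.module_axioms hom_\<pi>]
  gr_hom_zero[OF N.module_axioms N.module_axioms hom_h]
  gr_hom_zero[OF N.module_axioms N.module_axioms hom_\<delta>]
  gr_hom_zero[OF N.module_axioms N.module_axioms hom_\<alpha>]
  gr_hom_zero[OF N.module_axioms N.module_axioms hom_\<beta>]

lemma contraction_pointwise:
  shows dN_dN: "x \<in> carrier (N n) \<Longrightarrow> dN (n - 1) (dN n x) = \<zero>\<^bsub>N (n - 2)\<^esub>"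
    and dM_\<pi>: "x \<in> carrier (N n) \<Longrightarrow> dM n (\<pi> n x) = \<pi> (n - 1) (dN n x)"
    and dN_nabla: "y \<in> carrier (M n) \<Longrightarrow> dN n (nabla n y) = nabla (n - 1) (dM n y)"
    and h_h: "x \<in> carrier (N n) \<Longrightarrow> h (n + 1) (h n x) = \<zero>\<^bsub>N (n + 2)\<^esub>"
    and \<pi>_nabla: "y \<in> carrier (M n) \<Longrightarrow> \<pi> n (nabla n y) = y"
    and \<pi>_h: "x \<in> carrier (N n) \<Longrightarrow> \<pi> (n + 1) (h n x) = \<zero>\<^bsub>M (n + 1)\<^esub>"
    and h_nabla: "y \<in> carrier (M n) \<Longrightarrow> h n (nabla n y) = \<zero>\<^bsub>N (n + 1)\<^esub>"
  using contr
  by (auto simp: contraction_def weak_contraction_def chain_complex_def chain_map_def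
      gr_eq_def gr_comp_def gr_zero_def gr_id_def)

text \<open>\<open>Dh = Id - \<nabla>\<pi>\<close> is freed of its subtraction, so that additivity
  alone suffices to apply an operator to it.\<close>

lemma homotopy:
  assumes "x \<in> carrier (N n)"
  shows "x = (dN (n + 1) (h n x) \<oplus>\<^bsub>N n\<^esub> h (n - 1) (dN n x)) \<oplus>\<^bsub>N n\<^esub> nabla n (\<pi> n x)"
proof -
  have "dN (n + 1) (h n x) \<oplus>\<^bsub>N n\<^esub> h (n - 1) (dN n x) = x \<ominus>\<^bsub>N n\<^esub> nabla n (\<pi> n x)"
    using contr assms
    by (simp add: contraction_def weak_contraction_def gr_eq_def gr_D_def gr_add_def
        gr_diff_def gr_comp_def gr_id_def)
  then show ?thesis
    using assms by (simp add: N.minus_eq N.a_assoc N.l_neg)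
qed

lemma differential_squared:
  assumes "x \<in> carrier (N n)"
  shows "dN (n - 1) (dN n x \<oplus>\<^bsub>N (n - 1)\<^esub> \<delta> n x) \<oplus>\<^bsub>N (n - 2)\<^esub>
    \<delta> (n - 1) (dN n x \<oplus>\<^bsub>N (n - 1)\<^esub> \<delta> n x) = \<zero>\<^bsub>N (n - 2)\<^esub>"
  using pert assms
  by (simp add: perturbation_def gr_eq_def gr_add_def gr_comp_def gr_zero_def)

text \<open>Expand \<open>(d + \<delta>)(d + \<delta>) = 0\<close> and drop the summand
  \<open>dd = 0\<close>.\<close>

lemma perturbation_squared:
  assumes "x \<in> carrier (N n)"
  shows "\<delta> (n - 1) (dN n x) \<oplus>\<^bsub>N (n - 2)\<^esub>
    (dN (n - 1) (\<delta> n x) \<oplus>\<^bsub>N (n - 2)\<^esub> \<delta> (n - 1) (\<delta> n x)) = \<zero>\<^bsub>N (n - 2)\<^esub>"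
  using differential_squared[OF assms] assms by (simp add: dN_dN N.add.m_ac)

section \<open>Relations between the inverses, the homotopy and the differentials\<close>

lemma inverse_pointwise:
  assumes "x \<in> carrier (N n)"
  shows \<alpha>_A: "\<alpha> n (x \<oplus>\<^bsub>N n\<^esub> h (n - 1) (\<delta> n x)) = x"
    and A_\<alpha>: "\<alpha> n x \<oplus>\<^bsub>N n\<^esub> h (n - 1) (\<delta> n (\<alpha> n x)) = x"
    and \<beta>_B: "\<beta> n (x \<oplus>\<^bsub>N n\<^esub> \<delta> (n + 1) (h n x)) = x"
    and B_\<beta>: "\<beta> n x \<oplus>\<^bsub>N n\<^esub> \<delta> (n + 1) (h n (\<beta> n x)) = x"
  \<comment> \<open>The rules \<open>additive\<close> would distribute \<open>\<alpha>\<close> and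
    \<open>\<beta>\<close> over the sums, which must stay intact here.\<close>
  using inv_\<alpha> inv_\<beta> assms
  by (simp_all add: gr_inverse_def gr_eq_def gr_add_def gr_comp_def gr_id_def del: additive)

text \<open>Applying \<open>h\<close> to \<open>B\<beta>x = x\<close> gives
  \<open>A(h\<beta>x) = hx\<close>, and \<open>\<alpha>\<close> cancels \<open>A\<close>.\<close>

lemma \<alpha>_h:
  assumes "x \<in> carrier (N n)"
  shows "\<alpha> (n + 1) (h n x) = h n (\<beta> n x)"
  using arg_cong[OF B_\<beta>[OF assms], of "h n"] \<alpha>_A[of "h n (\<beta> n x)" "n + 1"] assms by simp

text \<open>Dually, applying \<open>\<delta>\<close> to \<open>A\<alpha>x = x\<close> gives
  \<open>B(\<delta>\<alpha>x) = \<delta>x\<close>, and \<open>\<beta>\<close> cancels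
  \<open>B\<close>.\<close>

lemma \<beta>_\<delta>:
  assumes "x \<in> carrier (N n)"
  shows "\<beta> (n - 1) (\<delta> n x) = \<delta> n (\<alpha> n x)"
  using arg_cong[OF A_\<alpha>[OF assms], of "\<delta> n"] \<beta>_B[of "\<delta> n (\<alpha> n x)" "n - 1"] assms by simp

text \<open>In \<open>\<alpha>x + h\<delta>\<alpha>x = x\<close> the second summand is killed by
  \<open>h\<close> because \<open>hh = 0\<close>; in the same way \<open>\<pi>h = 0\<close> gives
  \<open>\<pi>\<alpha> = \<pi>\<close>.\<close>

lemma h_\<alpha>:
  assumes "x \<in> carrier (N n)"
  shows "h n (\<alpha> n x) = h n x"
  using arg_cong[OF A_\<alpha>[OF assms], of "h n"] h_h[of "\<delta> n (\<alpha> n x)" "n - 1"] assms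
  by (simp add: add.commute[of 1 n])

lemma \<pi>_\<alpha>:
  assumes "x \<in> carrier (N n)"
  shows "\<pi> n (\<alpha> n x) = \<pi> n x"
  using arg_cong[OF A_\<alpha>[OF assms], of "\<pi> n"] \<pi>_h[of "\<delta> n (\<alpha> n x)" "n - 1"] assms by simp

lemma \<beta>_fixes_kernel_h:
  assumes "x \<in> carrier (N n)" "h n x = \<zero>\<^bsub>N (n + 1)\<^esub>"
  shows "\<beta> n x = x"
  using \<beta>_B[OF assms(1)] assms by simp

text \<open>With \<open>y = (d + \<delta>)x\<close>, the relations
  \<open>(d + \<delta>)y = 0\<close> and \<open>dd = 0\<close> give
  \<open>h\<delta>y = -hd\<delta>x\<close>. This cancels the middle term when the summand
  \<open>\<delta>x\<close> of \<open>y\<close> is split by the homotopy identity, leaving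
  \<open>dh\<delta>x + \<nabla>\<pi>\<delta>x\<close>.\<close>

lemma A_differential:
  assumes x: "x \<in> carrier (N n)"
  defines "y \<equiv> dN n x \<oplus>\<^bsub>N (n - 1)\<^esub> \<delta> n x"
  shows "y \<oplus>\<^bsub>N (n - 1)\<^esub> h (n - 2) (\<delta> (n - 1) y) =
    dN n (x \<oplus>\<^bsub>N n\<^esub> h (n - 1) (\<delta> n x)) \<oplus>\<^bsub>N (n - 1)\<^esub> nabla (n - 1) (\<pi> (n - 1) (\<delta> n x))"
proof -
  let ?z = "\<delta> n x" and ?p = "N (n - 1)"
  let ?w = "\<delta> (n - 1) y"
  have y: "y \<in> carrier ?p" using x by (simp add: y_def)
  have "dN (n - 1) ?z \<oplus>\<^bsub>N (n - 2)\<^esub> ?w = \<zero>\<^bsub>N (n - 2)\<^esub>"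
    using differential_squared[OF x] x by (simp add: y_def dN_dN)
  then have hw: "h (n - 2) (dN (n - 1) ?z) \<oplus>\<^bsub>?p\<^esub> h (n - 2) ?w = \<zero>\<^bsub>?p\<^esub>"
    using x y additive(5)[of "dN (n - 1) ?z" "n - 2" ?w] zero(5)[of "n - 2"] by simp
  have z: "?z = (dN n (h (n - 1) ?z) \<oplus>\<^bsub>?p\<^esub> h (n - 2) (dN (n - 1) ?z)) \<oplus>\<^bsub>?p\<^esub>
      nabla (n - 1) (\<pi> (n - 1) ?z)"
    using homotopy[of ?z "n - 1"] x by simp
  have "y \<oplus>\<^bsub>?p\<^esub> h (n - 2) ?w = dN n x \<oplus>\<^bsub>?p\<^esub> ((dN n (h (n - 1) ?z) \<oplus>\<^bsub>?p\<^esub>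
      h (n - 2) (dN (n - 1) ?z)) \<oplus>\<^bsub>?p\<^esub> nabla (n - 1) (\<pi> (n - 1) ?z)) \<oplus>\<^bsub>?p\<^esub> h (n - 2) ?w"
    unfolding y_def using z by simp
  also have "\<dots> = dN n x \<oplus>\<^bsub>?p\<^esub> dN n (h (n - 1) ?z) \<oplus>\<^bsub>?p\<^esub> nabla (n - 1) (\<pi> (n - 1) ?z) \<oplus>\<^bsub>?p\<^esub>
      (h (n - 2) (dN (n - 1) ?z) \<oplus>\<^bsub>?p\<^esub> h (n - 2) ?w)"
    using x y by (simp add: N.add.m_ac)
  also have "\<dots> = dN n x \<oplus>\<^bsub>?p\<^esub> dN n (h (n - 1) ?z) \<oplus>\<^bsub>?p\<^esub> nabla (n - 1) (\<pi> (n - 1) ?z)"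
    unfolding hw using x by simp
  finally show ?thesis using x by simp
qed

text \<open>Apply \<open>\<delta>\<close> to the homotopy identity at \<open>x\<close>. The
  resulting term \<open>\<delta>dhx\<close> cancels against
  \<open>d\<delta>hx + \<delta>\<delta>hx\<close> by \<open>perturbation_squared\<close> at
  \<open>hx\<close>.\<close>

lemma differential_B:
  assumes x: "x \<in> carrier (N n)"
  defines "y \<equiv> x \<oplus>\<^bsub>N n\<^esub> \<delta> (n + 1) (h n x)"
  shows "dN n y \<oplus>\<^bsub>N (n - 1)\<^esub> \<delta> n y =
    (dN n x \<oplus>\<^bsub>N (n - 1)\<^esub> \<delta> n (h (n - 1) (dN n x))) \<oplus>\<^bsub>N (n - 1)\<^esub> \<delta> n (nabla n (\<pi> n x))"
proof -
  let ?w = "h n x" and ?p = "N (n - 1)"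
  have s: "\<delta> n (dN (n + 1) ?w) \<oplus>\<^bsub>?p\<^esub> (dN n (\<delta> (n + 1) ?w) \<oplus>\<^bsub>?p\<^esub> \<delta> n (\<delta> (n + 1) ?w)) = \<zero>\<^bsub>?p\<^esub>"
    using perturbation_squared[of ?w "n + 1"] x by simp
  have e: "\<delta> n x = (\<delta> n (dN (n + 1) ?w) \<oplus>\<^bsub>?p\<^esub> \<delta> n (h (n - 1) (dN n x))) \<oplus>\<^bsub>?p\<^esub>
      \<delta> n (nabla n (\<pi> n x))"
    using arg_cong[OF homotopy[OF x], of "\<delta> n"] x by simp
  have "dN n y \<oplus>\<^bsub>?p\<^esub> \<delta> n y = dN n x \<oplus>\<^bsub>?p\<^esub> dN n (\<delta> (n + 1) ?w) \<oplus>\<^bsub>?p\<^esub>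
      (\<delta> n x \<oplus>\<^bsub>?p\<^esub> \<delta> n (\<delta> (n + 1) ?w))"
    unfolding y_def using x by simp
  also have "\<dots> = (dN n x \<oplus>\<^bsub>?p\<^esub> \<delta> n (h (n - 1) (dN n x)) \<oplus>\<^bsub>?p\<^esub> \<delta> n (nabla n (\<pi> n x))) \<oplus>\<^bsub>?p\<^esub>
      (\<delta> n (dN (n + 1) ?w) \<oplus>\<^bsub>?p\<^esub> (dN n (\<delta> (n + 1) ?w) \<oplus>\<^bsub>?p\<^esub> \<delta> n (\<delta> (n + 1) ?w)))"
    unfolding e using x by (simp add: N.add.m_ac)
  finally show ?thesis unfolding s using x by simp
qed

section \<open>The perturbed data and their contraction identities\<close>

abbreviation "D \<equiv> \<pi> \<cdot>\<^bsub>-1\<^esub> (\<delta> \<cdot>\<^bsub>0\<^esub> (\<alpha> \<cdot>\<^bsub>0\<^esub> nabla))"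
abbreviation "dMD \<equiv> gr_add M (-1) dM D"
abbreviation "dN\<delta> \<equiv> gr_add N (-1) dN \<delta>"

lemma D_eq: "gr_eq M D (\<pi> \<cdot>\<^bsub>-1\<^esub> (\<beta> \<cdot>\<^bsub>-1\<^esub> (\<delta> \<cdot>\<^bsub>0\<^esub> nabla)))"
  by (simp add: gr_eq_def gr_comp_def \<beta>_\<delta>)

lemma h\<delta>_eq: "gr_eq N (\<alpha> \<cdot>\<^bsub>1\<^esub> h) (h \<cdot>\<^bsub>0\<^esub> \<beta>)"
  by (simp add: gr_eq_def gr_comp_def \<alpha>_h)

lemma hom_dMD: "gr_hom R M M (-1) dMD"
  by (rule gr_hom_gr_add gr_hom_comp homs M.module_axioms | simp)+

lemma hom_dN\<delta>: "gr_hom R N N (-1) dN\<delta>"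
  by (rule gr_hom_gr_add gr_hom_comp homs N.module_axioms)+

lemma hom_nabla\<delta>: "gr_hom R M N 0 (\<alpha> \<cdot>\<^bsub>0\<^esub> nabla)"
  by (rule gr_hom_comp homs | simp)+

lemma hom_\<pi>\<delta>: "gr_hom R N M 0 (\<pi> \<cdot>\<^bsub>0\<^esub> \<beta>)"
  by (rule gr_hom_comp homs | simp)+

lemma hom_h\<delta>: "gr_hom R N N 1 (\<alpha> \<cdot>\<^bsub>1\<^esub> h)"
  by (rule gr_hom_comp homs | simp)+

text \<open>By \<open>h\<alpha> = h\<close> and \<open>h\<nabla> = 0\<close> the element
  \<open>\<alpha>\<nabla>x\<close> is killed by \<open>h\<close>, hence fixed by
  \<open>\<beta>\<close>; then \<open>\<pi>\<alpha> = \<pi>\<close> and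
  \<open>\<pi>\<nabla> = Id\<close> finish.\<close>

lemma \<pi>\<delta>_nabla\<delta>:
  assumes "x \<in> carrier (M n)"
  shows "\<pi> n (\<beta> n (\<alpha> n (nabla n x))) = x"
  using assms by (simp add: \<beta>_fixes_kernel_h h_\<alpha> h_nabla \<pi>_\<alpha> \<pi>_nabla)

text \<open>Rewritten as \<open>h\<beta>x\<close>, the element \<open>\<alpha>hx\<close> is killed
  by \<open>h\<close>, so \<open>\<beta>\<close> fixes it and \<open>\<pi>h = 0\<close>
  applies.\<close>

lemma \<pi>\<delta>_h\<delta>:
  assumes "x \<in> carrier (N n)"
  shows "\<pi> (n + 1) (\<beta> (n + 1) (\<alpha> (n + 1) (h n x))) = \<zero>\<^bsub>M (n + 1)\<^esub>"
  using assms \<beta>_fixes_kernel_h[of "h n (\<beta> n x)" "n + 1"]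
  by (simp add: \<alpha>_h h_h \<pi>_h add.commute[of 2 n])

lemma h\<delta>_nabla\<delta>:
  assumes "x \<in> carrier (M n)"
  shows "\<alpha> (n + 1) (h n (\<alpha> n (nabla n x))) = \<zero>\<^bsub>N (n + 1)\<^esub>"
  using assms zero(7)[of "n + 1"] by (simp add: h_\<alpha> h_nabla)

lemma h\<delta>_h\<delta>:
  assumes "x \<in> carrier (N n)"
  shows "\<alpha> (n + 2) (h (n + 1) (\<alpha> (n + 1) (h n x))) = \<zero>\<^bsub>N (n + 2)\<^esub>"
  using assms zero(7)[of "n + 2"] by (simp add: h_\<alpha> h_h)

text \<open>Evaluating \<open>A(d + \<delta>) = dA + \<nabla>\<pi>\<delta>\<close> at
  \<open>\<alpha>\<nabla>x\<close>, where \<open>A\<alpha> = Id\<close>, gives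
  \<open>\<nabla>(d + \<D>)x\<close> on the right; \<open>\<alpha>\<close> then removes
  \<open>A\<close> on the left.\<close>

lemma nabla\<delta>_chain_map:
  assumes x: "x \<in> carrier (M n)"
  shows "dN\<delta> n (\<alpha> n (nabla n x)) = \<alpha> (n - 1) (nabla (n - 1) (dMD n x))"
proof -
  let ?y = "\<alpha> n (nabla n x)"
  let ?z = "dN n ?y \<oplus>\<^bsub>N (n - 1)\<^esub> \<delta> n ?y"
  have "?z \<oplus>\<^bsub>N (n - 1)\<^esub> h (n - 2) (\<delta> (n - 1) ?z) =
      dN n (nabla n x) \<oplus>\<^bsub>N (n - 1)\<^esub> nabla (n - 1) (\<pi> (n - 1) (\<delta> n ?y))"
    using A_differential[of ?y n] A_\<alpha>[of "nabla n x" n] x by (simp del: additive)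
  also have "\<dots> = nabla (n - 1) (dMD n x)"
    using x by (simp add: gr_add_def gr_comp_def dN_nabla)
  finally have "\<alpha> (n - 1) (nabla (n - 1) (dMD n x)) = ?z"
    using \<alpha>_A[of ?z "n - 1"] x by (simp del: additive)
  then show ?thesis by (simp add: gr_add_def)
qed

text \<open>Evaluating \<open>(d + \<delta>)B = Bd + \<delta>\<nabla>\<pi>\<close> at
  \<open>\<beta>x\<close> gives \<open>(d + \<delta>)x\<close> on the left. Apply
  \<open>\<pi>\<beta>\<close>: \<open>\<beta>\<close> cancels \<open>B\<close> in the first term,
  and \<open>\<beta>\<delta> = \<delta>\<alpha>\<close> turns the second into
  \<open>\<D>\<pi>\<beta>x\<close>.\<close>

lemma \<pi>\<delta>_chain_map:
  assumes x: "x \<in> carrier (N n)"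
  shows "dMD n (\<pi> n (\<beta> n x)) = \<pi> (n - 1) (\<beta> (n - 1) (dN\<delta> n x))"
proof -
  let ?y = "\<beta> n x"
  have "dN\<delta> n x = (dN n ?y \<oplus>\<^bsub>N (n - 1)\<^esub> \<delta> n (h (n - 1) (dN n ?y))) \<oplus>\<^bsub>N (n - 1)\<^esub>
      \<delta> n (nabla n (\<pi> n ?y))"
    using differential_B[of ?y n] B_\<beta>[OF x] x by (simp add: gr_add_def del: additive)
  moreover have "\<beta> (n - 1) (dN n ?y \<oplus>\<^bsub>N (n - 1)\<^esub> \<delta> n (h (n - 1) (dN n ?y))) = dN n ?y"
    using \<beta>_B[of "dN n ?y" "n - 1"] x by (simp del: additive)
  ultimately have "\<beta> (n - 1) (dN\<delta> n x) =
      dN n ?y \<oplus>\<^bsub>N (n - 1)\<^esub> \<delta> n (\<alpha> n (nabla n (\<pi> n ?y)))"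
    using x additive(8)[of "dN n ?y \<oplus>\<^bsub>N (n - 1)\<^esub> \<delta> n (h (n - 1) (dN n ?y))" "n - 1"
        "\<delta> n (nabla n (\<pi> n ?y))"] by (simp add: \<beta>_\<delta> del: additive)
  then show ?thesis
    using x by (simp add: gr_add_def gr_comp_def dM_\<pi>)
qed

text \<open>With \<open>z = (d + \<delta>)\<alpha>hx\<close>, the sum
  \<open>Az + h(d + \<delta>)x + \<nabla>\<pi>\<beta>x\<close> is shown to equal \<open>Ax\<close>;
  applying \<open>\<alpha>\<close> gives the claim.\<close>

lemma perturbed_homotopy:
  assumes x: "x \<in> carrier (N n)"
  shows "dN\<delta> (n + 1) (\<alpha> (n + 1) (h n x)) \<oplus>\<^bsub>N n\<^esub> \<alpha> n (h (n - 1) (dN\<delta> n x)) =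
    x \<ominus>\<^bsub>N n\<^esub> \<alpha> n (nabla n (\<pi> n (\<beta> n x)))"
proof -
  let ?y = "\<alpha> (n + 1) (h n x)" and ?v = "\<beta> n x" and ?p = "N n"
  let ?z = "dN (n + 1) ?y \<oplus>\<^bsub>?p\<^esub> \<delta> (n + 1) ?y"
  let ?q = "nabla n (\<pi> n (\<delta> (n + 1) ?y))" and ?r = "nabla n (\<pi> n ?v)"
  have z: "?z \<in> carrier ?p" using x by simp
  \<comment> \<open>This is \<open>B\<beta>x = x\<close> with \<open>h\<beta>\<close> replaced by
    \<open>\<alpha>h\<close>. Its image under \<open>\<nabla>\<pi>\<close> lets \<open>?r\<close>
    absorb the term \<open>?q\<close> left over from \<open>A_differential\<close>, restoring the
    \<open>\<nabla>\<pi>x\<close> of the original homotopy identity.\<close>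
  have "?v \<oplus>\<^bsub>?p\<^esub> \<delta> (n + 1) ?y = x" using B_\<beta>[OF x] x by (simp add: \<alpha>_h)
  from arg_cong[OF this, of "\<lambda>t. nabla n (\<pi> n t)"]
  have vx: "nabla n (\<pi> n x) = ?r \<oplus>\<^bsub>?p\<^esub> ?q" using x by simp
  have Az: "?z \<oplus>\<^bsub>?p\<^esub> h (n - 1) (\<delta> n ?z) = dN (n + 1) (h n x) \<oplus>\<^bsub>?p\<^esub> ?q"
    using A_differential[of ?y "n + 1"] A_\<alpha>[of "h n x" "n + 1"] x by (simp del: additive)
  have "((?z \<oplus>\<^bsub>?p\<^esub> h (n - 1) (\<delta> n ?z)) \<oplus>\<^bsub>?p\<^esub> h (n - 1) (dN\<delta> n x)) \<oplus>\<^bsub>?p\<^esub> ?r =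
      ((dN (n + 1) (h n x) \<oplus>\<^bsub>?p\<^esub> h (n - 1) (dN n x)) \<oplus>\<^bsub>?p\<^esub> nabla n (\<pi> n x))
      \<oplus>\<^bsub>?p\<^esub> h (n - 1) (\<delta> n x)"
    unfolding Az vx using x by (simp add: gr_add_def N.add.m_ac)
  also have "\<dots> = x \<oplus>\<^bsub>?p\<^esub> h (n - 1) (\<delta> n x)"
    using homotopy[OF x] by simp
  finally have "\<alpha> n (((?z \<oplus>\<^bsub>?p\<^esub> h (n - 1) (\<delta> n ?z)) \<oplus>\<^bsub>?p\<^esub> h (n - 1) (dN\<delta> n x)) \<oplus>\<^bsub>?p\<^esub> ?r) = x"
    using \<alpha>_A[OF x] by simp
  moreover have "h (n - 1) (dN\<delta> n x) \<in> carrier ?p"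
    using x by (simp add: gr_add_def)
  ultimately have "(?z \<oplus>\<^bsub>?p\<^esub> \<alpha> n (h (n - 1) (dN\<delta> n x))) \<oplus>\<^bsub>?p\<^esub> \<alpha> n ?r = x"
    using z x \<alpha>_A[OF z]
      additive(7)[of "(?z \<oplus>\<^bsub>?p\<^esub> h (n - 1) (\<delta> n ?z)) \<oplus>\<^bsub>?p\<^esub> h (n - 1) (dN\<delta> n x)" n ?r]
      additive(7)[of "?z \<oplus>\<^bsub>?p\<^esub> h (n - 1) (\<delta> n ?z)" n "h (n - 1) (dN\<delta> n x)"]
    by (simp del: additive)
  moreover have "\<alpha> n (h (n - 1) (dN\<delta> n x)) \<in> carrier ?p"
    using x by (simp add: gr_add_def)
  ultimately show ?thesis
    using z x
      N.add.inv_solve_right[of "?z \<oplus>\<^bsub>?p\<^esub> \<alpha> n (h (n - 1) (dN\<delta> n x))" n x "\<alpha> n ?r"]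
    by (simp add: gr_add_def N.minus_eq del: additive)
qed

text \<open>The chain map identity for \<open>\<alpha>\<nabla>\<close>, used twice, carries the
  square to \<open>(d + \<delta>)(d + \<delta>) = 0\<close> on \<open>N\<close>; the left inverse
  \<open>\<pi>\<beta>\<close> brings the vanishing back to \<open>M\<close>.\<close>

lemma dMD_squared:
  assumes x: "x \<in> carrier (M n)"
  shows "dMD (n - 1) (dMD n x) = \<zero>\<^bsub>M (n - 2)\<^esub>"
proof -
  have cl: "dMD n x \<in> carrier (M (n - 1))"
    by (rule gr_hom_closed[OF hom_dMD x]) simp
  have cl2: "dMD (n - 1) (dMD n x) \<in> carrier (M (n - 2))"
    by (rule gr_hom_closed[OF hom_dMD cl]) simp
  have "\<alpha> (n - 2) (nabla (n - 2) (dMD (n - 1) (dMD n x))) = dN\<delta> (n - 1) (dN\<delta> n (\<alpha> n (nabla n x)))"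
    using nabla\<delta>_chain_map[OF cl] nabla\<delta>_chain_map[OF x] by simp
  also have "\<dots> = \<zero>\<^bsub>N (n - 2)\<^esub>"
    using differential_squared[of "\<alpha> n (nabla n x)" n] x by (simp add: gr_add_def del: additive)
  finally show ?thesis
    using \<pi>\<delta>_nabla\<delta>[OF cl2] zero(4)[of "n - 2"] zero(8)[of "n - 2"] by simp
qed

theorem contraction_perturbed:
  "contraction R M dMD N dN\<delta> (\<alpha> \<cdot>\<^bsub>0\<^esub> nabla) (\<pi> \<cdot>\<^bsub>0\<^esub> \<beta>) (\<alpha> \<cdot>\<^bsub>1\<^esub> h)"
proof -
  \<comment> \<open>Besides being a side condition, this retraction identity yields injectivity of
    \<open>\<alpha>\<nabla>\<close> and surjectivity of \<open>\<pi>\<beta>\<close>.\<close>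
  have retr: "gr_eq M ((\<pi> \<cdot>\<^bsub>0\<^esub> \<beta>) \<cdot>\<^bsub>0\<^esub> (\<alpha> \<cdot>\<^bsub>0\<^esub> nabla)) gr_id"
    by (simp add: gr_eq_def gr_comp_def gr_id_def \<pi>\<delta>_nabla\<delta>)
  \<comment> \<open>Only composites with outer operator \<open>dMD\<close> are unfolded, so that
    \<open>D\<close> keeps the form it has in \<open>dMD_squared\<close>.\<close>
  have "chain_complex R M dMD"
    using hom_dMD dMD_squared M.module_axioms
    by (simp add: chain_complex_def gr_eq_def gr_zero_def gr_comp_def[of dMD])
  moreover have "chain_complex R N dN\<delta>"
    using hom_dN\<delta> pert N.module_axioms by (simp add: chain_complex_def perturbation_def)
  moreover have "chain_map R N dN\<delta> M dMD (\<pi> \<cdot>\<^bsub>0\<^esub> \<beta>)"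
    using hom_\<pi>\<delta> \<pi>\<delta>_chain_map
    by (simp add: chain_map_def gr_eq_def gr_comp_def)
  moreover have "chain_map R M dMD N dN\<delta> (\<alpha> \<cdot>\<^bsub>0\<^esub> nabla)"
    using hom_nabla\<delta> nabla\<delta>_chain_map
    by (simp add: chain_map_def gr_eq_def gr_comp_def)
  moreover have "gr_eq N (gr_D N dN\<delta> (\<alpha> \<cdot>\<^bsub>1\<^esub> h))
      (gr_diff N 0 gr_id ((\<alpha> \<cdot>\<^bsub>0\<^esub> nabla) \<cdot>\<^bsub>0\<^esub> (\<pi> \<cdot>\<^bsub>0\<^esub> \<beta>)))"
    \<comment> \<open>Restricting \<open>gr_add_def\<close> to degree \<open>0\<close> opens the
      outer sum of \<open>gr_D\<close> and keeps \<open>dN\<delta>\<close>, a sum of degree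
      \<open>-1\<close>, folded.\<close>
    using perturbed_homotopy
    by (simp add: gr_eq_def gr_D_def gr_add_def[of N 0] gr_diff_def gr_id_def gr_comp_def)
  moreover have "gr_eq N ((\<alpha> \<cdot>\<^bsub>1\<^esub> h) \<cdot>\<^bsub>1\<^esub> (\<alpha> \<cdot>\<^bsub>1\<^esub> h)) (gr_zero N 2)"
    using h\<delta>_h\<delta> by (simp add: gr_eq_def gr_comp_def gr_zero_def add.commute[of 2])
  moreover have "gr_eq N ((\<pi> \<cdot>\<^bsub>0\<^esub> \<beta>) \<cdot>\<^bsub>1\<^esub> (\<alpha> \<cdot>\<^bsub>1\<^esub> h)) (gr_zero M 1)"
    using \<pi>\<delta>_h\<delta> by (simp add: gr_eq_def gr_comp_def gr_zero_def)
  moreover have "gr_eq M ((\<alpha> \<cdot>\<^bsub>1\<^esub> h) \<cdot>\<^bsub>0\<^esub> (\<alpha> \<cdot>\<^bsub>0\<^esub> nabla)) (gr_zero N 1)"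
    using h\<delta>_nabla\<delta> by (simp add: gr_eq_def gr_comp_def gr_zero_def)
  ultimately show ?thesis
    unfolding contraction_def weak_contraction_def
    using retr hom_h\<delta> gr_inj_if_left_inverse[OF retr]
      gr_surj_if_right_inverse[OF hom_nabla\<delta> hom_\<pi>\<delta> retr]
    by blast
qed

end

theorem corollary6p5:
  fixes R :: "('r, 'c) ring_scheme"
    and M :: "('r, 'm) gr_module" and dM :: "('m, 'm) gr_op"
    and N :: "('r, 'n) gr_module" and dN :: "('n, 'n) gr_op"
    and nabla :: "('m, 'n) gr_op" and \<pi> :: "('n, 'm) gr_op" and h :: "('n, 'n) gr_op"
    and \<delta> :: "('n, 'n) gr_op"
    and \<alpha> \<beta> h\<delta> :: "('n, 'n) gr_op" and \<D> :: "('m, 'm) gr_op"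
    and nabla\<delta> :: "('m, 'n) gr_op" and \<pi>\<delta> :: "('n, 'm) gr_op"
  assumes "cring R"
    and "contraction R M dM N dN nabla \<pi> h"
    and "perturbation R N dN \<delta>"
    and "gr_invertible R N (gr_add N 0 gr_id (h \<cdot>\<^bsub>-1\<^esub> \<delta>))"
    and "gr_invertible R N (gr_add N 0 gr_id (\<delta> \<cdot>\<^bsub>1\<^esub> h))"
    and "\<alpha> = gr_inv R N (gr_add N 0 gr_id (h \<cdot>\<^bsub>-1\<^esub> \<delta>))"
    and "\<beta> = gr_inv R N (gr_add N 0 gr_id (\<delta> \<cdot>\<^bsub>1\<^esub> h))"
    and "\<D> = \<pi> \<cdot>\<^bsub>-1\<^esub> (\<delta> \<cdot>\<^bsub>0\<^esub> (\<alpha> \<cdot>\<^bsub>0\<^esub> nabla))"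
    and "nabla\<delta> = \<alpha> \<cdot>\<^bsub>0\<^esub> nabla"
    and "\<pi>\<delta> = \<pi> \<cdot>\<^bsub>0\<^esub> \<beta>"
    and "h\<delta> = \<alpha> \<cdot>\<^bsub>1\<^esub> h"
  shows "gr_eq M \<D> (\<pi> \<cdot>\<^bsub>-1\<^esub> (\<beta> \<cdot>\<^bsub>-1\<^esub> (\<delta> \<cdot>\<^bsub>0\<^esub> nabla)))
    \<and> gr_eq N h\<delta> (h \<cdot>\<^bsub>0\<^esub> \<beta>)
    \<and> contraction R M (gr_add M (-1) dM \<D>) N (gr_add N (-1) dN \<delta>) nabla\<delta> \<pi>\<delta> h\<delta>"
proof -
  \<comment> \<open>Invertibility makes the operators chosen by \<open>gr_inv\<close> genuine
    two-sided inverses, as the locale requires.\<close>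
  interpret perturbed_contraction R M dM N dN nabla \<pi> h \<delta> \<alpha> \<beta>
    using assms by (simp add: perturbed_contraction_def gr_inverse_gr_inv)
  show ?thesis
    using D_eq h\<delta>_eq contraction_perturbed unfolding assms(8-11) by blast
qed

end
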